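(* Let $\gamma$ be a modulus function, let $X\subset\mathbb{R}$, and let $\mathcal{BAC}_\gamma(X)$ be the set of all functions $f:X\to\mathbb{R}$ that are bounded and $\gamma$-approximately continuous on $X$. Then $(\mathcal{BAC}_\gamma(X),\|\cdot\|_\infty)$ is a Banach space, where $\|f\|_\infty=\sup_{x\in X}|f(x)|$.
   Context: For subsets of $\mathbb{R}$, $|\cdot|$ denotes Lebesgue measure, and $A^c=\mathbb{R}\setminus A$. A modulus function is a function $\gamma:[0,\infty)\to[0,\infty)$ such that (i) $\gamma(a)=0\Leftrightarrow a=0$; (ii) $\gamma(a+b)\le\gamma(a)+\gamma(b)$ for all $a,b\ge 0$; (iii) $\gamma$ is right-continuous at $0$; (iv) $\gamma$ is increasing (in the weak sense: $a\le b$ implies $\gamma(a)\le\gamma(b)$). For a Lebesgue measurable $A\subset\mathbb{R}$, $\mathcal{D}_\gamma(A)$ is the set of all $x\in\mathbb{R}$ with $\lim_{\alpha\to 0^+}\frac{\gamma(|(x-\alpha,x+\alpha)\cap A^c|)}{\gamma(2\alpha)}=0$. A function $f:X\to\mathbb{R}$ is $\gamma$-approximately continuous on $X$ if for each $x_0\in X$ there exists a measurable set $A_{x_0}\subset X$ such that $x_0\in\mathcal{D}_\gamma(A_{x_0})$ and $f(x_0)=\lim_{x\to x_0,\ x\in A_{x_0}}f(x)$. It is bounded on $X$ if there is $M>0$ with $|f(x)|\le M$ for all $x\in X$. Vector space operations are pointwise.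
   Formalization: The set BAC_γ(X) is assumed to be nonempty; for some X, such as X = {0}, no function is γ-approximately continuous on X, so the set is empty and not a vector space. *)

theory Defs
  imports "HOL-Analysis.Analysis" "HOL-Algebra.Module"
begin

section \<open>Banach spaces on a carrier set\<close>

definition reals_ring :: "real ring" where
  "reals_ring = \<lparr>carrier = UNIV, monoid.mult = (*), one = 1, ring.zero = 0, add = (+)\<rparr>"

lemma field_reals_ring: "field reals_ring"
proof -
  have "cring reals_ring"
    by (rule cringI, rule abelian_groupI, goal_cases)
       (auto simp: reals_ring_def algebra_simps intro!: comm_monoidI exI[of _ "- x" for x :: real])
  then show ?thesis
    by (rule cring.cring_fieldI2)
       (auto simp: reals_ring_def intro: right_inverse)
qed

text \<open>
  A vector space over \<open>\<real>\<close> is a module over the field of real numbers. The type class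
  \<open>banach\<close> is not available here because the space below depends on a parameter and is a
  proper subset of a type. Completeness is spelled out, since the locale \<open>Metric_space\<close>
  requires symmetry of the distance also outside of the carrier.
\<close>

locale real_banach_space = module reals_ring V
  for V :: "(real, 'v, 'm) module_scheme" and nrm :: "'v \<Rightarrow> real" +
  assumes nrm_nonneg: "u \<in> carrier V \<Longrightarrow> 0 \<le> nrm u"
    and nrm_eq_zero_iff: "u \<in> carrier V \<Longrightarrow> nrm u = 0 \<longleftrightarrow> u = \<zero>\<^bsub>V\<^esub>"
    and nrm_smult: "u \<in> carrier V \<Longrightarrow> nrm (c \<odot>\<^bsub>V\<^esub> u) = \<bar>c\<bar> * nrm u"
    and nrm_triangle: "u \<in> carrier V \<Longrightarrow> v \<in> carrier V \<Longrightarrow> nrm (u \<oplus>\<^bsub>V\<^esub> v) \<le> nrm u + nrm v"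
    and complete: "(\<And>n. \<sigma> n \<in> carrier V) \<Longrightarrow>
        (\<And>e. e > 0 \<Longrightarrow> \<exists>N. \<forall>m\<ge>N. \<forall>n\<ge>N. nrm (\<sigma> m \<ominus>\<^bsub>V\<^esub> \<sigma> n) < e) \<Longrightarrow>
        \<exists>l\<in>carrier V. (\<lambda>n::nat. nrm (\<sigma> n \<ominus>\<^bsub>V\<^esub> l)) \<longlonglongrightarrow> 0"


section \<open>Function spaces with the supremum norm\<close>

text \<open>
  Functions \<open>X \<rightarrow> \<real>\<close> are represented by elements of \<open>extensional X\<close>, so that each of them has
  exactly one representative. The multiplicative part of the record is irrelevant for modules.
\<close>

definition fun_space :: "real set \<Rightarrow> (real \<Rightarrow> real) set \<Rightarrow> (real, real \<Rightarrow> real) module" where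
  "fun_space X F =
     \<lparr>carrier = F, monoid.mult = undefined, one = undefined,
      ring.zero = (\<lambda>x\<in>X. 0), add = (\<lambda>f g. \<lambda>x\<in>X. f x + g x),
      smult = (\<lambda>c f. \<lambda>x\<in>X. c * f x)\<rparr>"

text \<open>The supremum is taken in \<open>[0,\<infinity>)\<close>, so it is \<open>0\<close> for \<open>X = {}\<close>.\<close>

definition sup_norm :: "real set \<Rightarrow> (real \<Rightarrow> real) \<Rightarrow> real" where
  "sup_norm X f = (if X = {} then 0 else (SUP x\<in>X. \<bar>f x\<bar>))"


section \<open>\<open>\<gamma>\<close>-approximate continuity\<close>

text \<open>Only the values of \<open>\<gamma>\<close> on \<open>[0,\<infinity>)\<close> matter.\<close>

definition modulus_function :: "(real \<Rightarrow> real) \<Rightarrow> bool" where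
  "modulus_function \<gamma> \<longleftrightarrow>
     (\<forall>a\<ge>0. \<gamma> a \<ge> 0) \<and>
     (\<forall>a\<ge>0. \<gamma> a = 0 \<longleftrightarrow> a = 0) \<and>
     (\<forall>a\<ge>0. \<forall>b\<ge>0. \<gamma> (a + b) \<le> \<gamma> a + \<gamma> b) \<and>
     continuous (at_right 0) \<gamma> \<and>
     mono_on {0..} \<gamma>"

definition density_points :: "(real \<Rightarrow> real) \<Rightarrow> real set \<Rightarrow> real set" where
  "density_points \<gamma> A =
     {x. ((\<lambda>\<alpha>. \<gamma> (measure lebesgue ({x - \<alpha><..<x + \<alpha>} \<inter> - A)) / \<gamma> (2 * \<alpha>)) \<longlongrightarrow> 0) (at_right 0)}"

definition approx_continuous_on :: "(real \<Rightarrow> real) \<Rightarrow> real set \<Rightarrow> (real \<Rightarrow> real) \<Rightarrow> bool" where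
  "approx_continuous_on \<gamma> X f \<longleftrightarrow>
     (\<forall>x0\<in>X. \<exists>A\<in>sets lebesgue. A \<subseteq> X \<and> x0 \<in> density_points \<gamma> A \<and>
        (f \<longlongrightarrow> f x0) (at x0 within A))"

definition bounded_fun_on :: "real set \<Rightarrow> (real \<Rightarrow> real) \<Rightarrow> bool" where
  "bounded_fun_on X f \<longleftrightarrow> (\<exists>M>0. \<forall>x\<in>X. \<bar>f x\<bar> \<le> M)"

definition BAC :: "(real \<Rightarrow> real) \<Rightarrow> real set \<Rightarrow> (real \<Rightarrow> real) set" where
  "BAC \<gamma> X = {f \<in> extensional X. bounded_fun_on X f \<and> approx_continuous_on \<gamma> X f}"

end

theory Submission
  imports Defs
begin

text \<open>
  The substance of the theorem is that \<open>\<gamma>\<close>-approximate continuity is stable under sums and under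
  uniform limits. For uniform limits the definition is awkward: each approximant comes with
  its own witnessing set, and one has to exhibit a single set along which the limit function
  converges.

  What resolves this is the characterization \<open>approx_continuous_on_iff\<close>: it suffices to find, for
  each \<open>\<epsilon> > 0\<close> separately, a set with density point \<open>x0\<close> on which \<open>f\<close> stays within \<open>\<epsilon>\<close> of \<open>f x0\<close>.
  With it, sums follow by intersecting two witnesses, and a uniform limit inherits the witness
  of one sufficiently close approximant, by the usual \<open>\<epsilon>/3\<close> argument.

  The characterization rests on the diagonal construction \<open>density_points_diagonal\<close>: countably
  many sets with common density point \<open>x0\<close> admit one set with density point \<open>x0\<close> that is contained
  in each of them near \<open>x0\<close>. One may make the sets decreasing, since subadditivity of \<open>\<gamma>\<close> gives
  closure under finite intersections. The \<open>k\<close>-th set \<open>B k\<close> is then imposed only at distance less than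
  \<open>h k\<close> from \<open>x0\<close>, for radii \<open>h k\<close> that tend to \<open>0\<close> so fast that \<open>\<gamma> (2 * h (k + 1))\<close> is negligible
  against \<open>\<gamma> (2 * h k)\<close>. At a scale \<open>\<alpha>\<close> between \<open>h (k + 1)\<close> and \<open>h k\<close>, the missing part lies
  outside \<open>B k\<close>, or outside \<open>B (k + 1)\<close> at distance less than \<open>h (k + 1)\<close>, or at distance less than
  \<open>h (k + 2)\<close>. So three terms suffice and no infinite sum has to be estimated; right-continuity
  of \<open>\<gamma>\<close> at \<open>0\<close> is what makes radii of this kind available.

  The rest is the standard argument for bounded functions: a sequence that is Cauchy in the
  supremum norm is uniformly Cauchy, hence has a uniform limit. That the space is inhabited
  matters for the zero vector: if some point of \<open>X\<close> is not a density point of any measurable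
  subset of \<open>X\<close>, then no function is approximately continuous on \<open>X\<close>; otherwise the witnesses of
  one member serve for the constants.
\<close>


section \<open>Modulus functions\<close>

lemma modulus_function_nonneg: "modulus_function \<gamma> \<Longrightarrow> 0 \<le> a \<Longrightarrow> 0 \<le> \<gamma> a"
  by (simp add: modulus_function_def)

lemma modulus_function_pos:
  assumes "modulus_function \<gamma>" "0 < a"
  shows "0 < \<gamma> a"
proof -
  have "0 \<le> \<gamma> a" "\<gamma> a \<noteq> 0"
    using assms by (auto simp: modulus_function_def)
  then show ?thesis by simp
qed

lemma modulus_function_mono:
  "modulus_function \<gamma> \<Longrightarrow> 0 \<le> a \<Longrightarrow> a \<le> b \<Longrightarrow> \<gamma> a \<le> \<gamma> b"
  by (auto simp: modulus_function_def intro: mono_onD)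

lemma modulus_function_subadditive:
  "modulus_function \<gamma> \<Longrightarrow> 0 \<le> a \<Longrightarrow> 0 \<le> b \<Longrightarrow> \<gamma> (a + b) \<le> \<gamma> a + \<gamma> b"
  by (simp add: modulus_function_def)

lemma modulus_function_mono_add:
  assumes "modulus_function \<gamma>" "0 \<le> c" "0 \<le> a" "0 \<le> b" "c \<le> a + b"
  shows "\<gamma> c \<le> \<gamma> a + \<gamma> b"
  using modulus_function_mono[OF assms(1,2,5)] modulus_function_subadditive[OF assms(1,3,4)]
  by linarith

lemma modulus_function_small:
  assumes "modulus_function \<gamma>" "0 < e"
  shows "\<exists>d>0. \<forall>a. 0 < a \<and> a < d \<longrightarrow> \<gamma> a < e"
proof -
  have "(\<gamma> \<longlongrightarrow> 0) (at_right 0)"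
    using assms(1) by (auto simp: modulus_function_def continuous_within)
  then have "\<forall>\<^sub>F a in at_right 0. \<gamma> a < e"
    using assms(2) by (rule order_tendstoD)
  then show ?thesis
    by (auto simp: eventually_at_right_field)
qed


section \<open>Density points\<close>

text \<open>
  Clearing the denominator, which is positive for \<open>\<alpha> > 0\<close>, turns the limit into inequalities
  between values of \<open>\<gamma>\<close>, to which monotonicity and subadditivity apply directly.
\<close>

lemma density_points_iff:
  assumes "modulus_function \<gamma>"
  shows "x \<in> density_points \<gamma> A \<longleftrightarrow>
    (\<forall>e>0. \<exists>d>0. \<forall>\<alpha>. 0 < \<alpha> \<and> \<alpha> < d \<longrightarrow>
       \<gamma> (measure lebesgue ({x - \<alpha><..<x + \<alpha>} \<inter> - A)) \<le> e * \<gamma> (2 * \<alpha>))"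
  (is "_ \<longleftrightarrow> (\<forall>e>0. ?small e)")
proof -
  let ?m = "\<lambda>\<alpha>. measure lebesgue ({x - \<alpha><..<x + \<alpha>} \<inter> - A)"
  have small_iff: "?small e \<longleftrightarrow> (\<forall>\<^sub>F \<alpha> in at_right 0. norm (\<gamma> (?m \<alpha>) / \<gamma> (2 * \<alpha>)) \<le> e)" for e
  proof -
    have "norm (\<gamma> (?m \<alpha>) / \<gamma> (2 * \<alpha>)) \<le> e \<longleftrightarrow> \<gamma> (?m \<alpha>) \<le> e * \<gamma> (2 * \<alpha>)" if "0 < \<alpha>" for \<alpha>
      using modulus_function_pos[OF assms, of "2 * \<alpha>"] that
        modulus_function_nonneg[OF assms, of "?m \<alpha>"]
      by (simp add: divide_simps)
    then show ?thesis
      by (auto simp: eventually_at_right_field)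
  qed
  have "x \<in> density_points \<gamma> A \<longleftrightarrow>
      (\<forall>e>0. \<forall>\<^sub>F \<alpha> in at_right 0. norm (\<gamma> (?m \<alpha>) / \<gamma> (2 * \<alpha>)) < e)"
    by (simp add: density_points_def tendsto_iff)
  also have "\<dots> \<longleftrightarrow> (\<forall>e>0. \<forall>\<^sub>F \<alpha> in at_right 0. norm (\<gamma> (?m \<alpha>) / \<gamma> (2 * \<alpha>)) \<le> e)"
  proof safe
    fix e :: real
    assume "\<forall>e>0. \<forall>\<^sub>F \<alpha> in at_right 0. norm (\<gamma> (?m \<alpha>) / \<gamma> (2 * \<alpha>)) < e" "0 < e"
    then show "\<forall>\<^sub>F \<alpha> in at_right 0. norm (\<gamma> (?m \<alpha>) / \<gamma> (2 * \<alpha>)) \<le> e"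
      by (auto elim: eventually_mono dest!: spec[of _ e])
  next
    fix e :: real
    assume *: "\<forall>e>0. \<forall>\<^sub>F \<alpha> in at_right 0. norm (\<gamma> (?m \<alpha>) / \<gamma> (2 * \<alpha>)) \<le> e" and "0 < e"
    then have "\<forall>\<^sub>F \<alpha> in at_right 0. norm (\<gamma> (?m \<alpha>) / \<gamma> (2 * \<alpha>)) \<le> e / 2"
      by (meson half_gt_zero)
    then show "\<forall>\<^sub>F \<alpha> in at_right 0. norm (\<gamma> (?m \<alpha>) / \<gamma> (2 * \<alpha>)) < e"
      by (rule eventually_mono) (use \<open>0 < e\<close> in linarith)
  qed
  finally show ?thesis
    by (simp only: small_iff)
qed

lemma lmeasurable_interval_Int_Compl:
  fixes a b :: real
  assumes "B \<in> sets lebesgue"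
  shows "{a<..<b} \<inter> - B \<in> lmeasurable"
  using assms by (intro fmeasurable_Int_fmeasurable) (auto simp: Compl_in_sets_lebesgue)

text \<open>
  The part of an interval missing from \<open>A \<inter> B\<close> is covered by the parts missing from \<open>A\<close> and
  from \<open>B\<close>, so the two ratios add up by subadditivity of \<open>\<gamma>\<close>.
\<close>

lemma density_points_Int:
  assumes \<gamma>: "modulus_function \<gamma>"
    and meas: "A \<in> sets lebesgue" "B \<in> sets lebesgue"
    and x: "x \<in> density_points \<gamma> A" "x \<in> density_points \<gamma> B"
  shows "x \<in> density_points \<gamma> (A \<inter> B)"
  unfolding density_points_iff[OF \<gamma>]
proof (intro allI impI)
  fix e :: real
  assume "0 < e"
  let ?m = "\<lambda>\<alpha> A. measure lebesgue ({x - \<alpha><..<x + \<alpha>} \<inter> - A)"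
  obtain d1 where d1: "0 < d1"
    "\<And>\<alpha>. 0 < \<alpha> \<Longrightarrow> \<alpha> < d1 \<Longrightarrow> \<gamma> (?m \<alpha> A) \<le> e / 2 * \<gamma> (2 * \<alpha>)"
    using x(1) \<open>0 < e\<close> unfolding density_points_iff[OF \<gamma>] by (meson half_gt_zero)
  obtain d2 where d2: "0 < d2"
    "\<And>\<alpha>. 0 < \<alpha> \<Longrightarrow> \<alpha> < d2 \<Longrightarrow> \<gamma> (?m \<alpha> B) \<le> e / 2 * \<gamma> (2 * \<alpha>)"
    using x(2) \<open>0 < e\<close> unfolding density_points_iff[OF \<gamma>] by (meson half_gt_zero)
  have "\<gamma> (?m \<alpha> (A \<inter> B)) \<le> e * \<gamma> (2 * \<alpha>)" if "0 < \<alpha>" "\<alpha> < min d1 d2" for \<alpha>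
  proof -
    have "{x - \<alpha><..<x + \<alpha>} \<inter> - (A \<inter> B)
        = ({x - \<alpha><..<x + \<alpha>} \<inter> - A) \<union> ({x - \<alpha><..<x + \<alpha>} \<inter> - B)"
      by blast
    then have "?m \<alpha> (A \<inter> B) \<le> ?m \<alpha> A + ?m \<alpha> B"
      using meas by (simp add: measure_Un_le lmeasurable_interval_Int_Compl fmeasurableD)
    then have "\<gamma> (?m \<alpha> (A \<inter> B)) \<le> \<gamma> (?m \<alpha> A) + \<gamma> (?m \<alpha> B)"
      by (intro modulus_function_mono_add[OF \<gamma>]) auto
    with d1(2)[of \<alpha>] d2(2)[of \<alpha>] that show ?thesis
      by (simp add: algebra_simps)
  qed
  with d1(1) d2(1) show "\<exists>d>0. \<forall>\<alpha>. 0 < \<alpha> \<and> \<alpha> < d \<longrightarrow> \<gamma> (?m \<alpha> (A \<inter> B)) \<le> e * \<gamma> (2 * \<alpha>)"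
    by (intro exI[of _ "min d1 d2"]) auto
qed

text \<open>Being a density point is local: at scales below \<open>r\<close> the ball removes nothing.\<close>

lemma density_points_Int_ball:
  assumes \<gamma>: "modulus_function \<gamma>"
    and x: "x \<in> density_points \<gamma> A" and r: "0 < r"
  shows "x \<in> density_points \<gamma> (A \<inter> ball x r)"
  unfolding density_points_iff[OF \<gamma>]
proof (intro allI impI)
  fix e :: real
  assume "0 < e"
  then obtain d where d: "0 < d" "\<And>\<alpha>. 0 < \<alpha> \<Longrightarrow> \<alpha> < d \<Longrightarrow>
      \<gamma> (measure lebesgue ({x - \<alpha><..<x + \<alpha>} \<inter> - A)) \<le> e * \<gamma> (2 * \<alpha>)"
    using x unfolding density_points_iff[OF \<gamma>] by meson
  have "{x - \<alpha><..<x + \<alpha>} \<inter> - (A \<inter> ball x r) = {x - \<alpha><..<x + \<alpha>} \<inter> - A" if "\<alpha> < r" for \<alpha>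
    using that by (auto simp: dist_real_def)
  with d r show "\<exists>d>0. \<forall>\<alpha>. 0 < \<alpha> \<and> \<alpha> < d \<longrightarrow>
      \<gamma> (measure lebesgue ({x - \<alpha><..<x + \<alpha>} \<inter> - (A \<inter> ball x r))) \<le> e * \<gamma> (2 * \<alpha>)"
    by (intro exI[of _ "min d r"]) auto
qed

text \<open>
  The core of the argument. The set \<open>A\<close> imposes membership in \<open>B k\<close> only at distance less than
  \<open>h k\<close> from \<open>x\<close>. The radii satisfy two requirements: below \<open>h k\<close> the set \<open>B k\<close> already misses only
  a \<open>1 / (k + 1)\<close> fraction in the sense of \<open>\<gamma>\<close>, and a whole interval of radius \<open>h (k + 1)\<close> is worth
  at most a \<open>1 / (k + 1)\<close> fraction of one of radius \<open>h k\<close>. The second requirement absorbs all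
  constraints with index at least \<open>k + 2\<close> in one interval.
\<close>

lemma density_points_decseq_diagonal:
  assumes \<gamma>: "modulus_function \<gamma>"
    and meas: "\<And>k. B k \<in> sets lebesgue"
    and dec: "decseq B"
    and x: "\<And>k. x \<in> density_points \<gamma> (B k)"
  obtains A h where "A \<in> sets lebesgue" "A \<subseteq> B 0" "x \<in> density_points \<gamma> A"
    "\<And>k::nat. 0 < h k" "\<And>k. A \<inter> ball x (h k) \<subseteq> B k"
proof -
  define m where "m \<alpha> S = measure lebesgue ({x - \<alpha><..<x + \<alpha>} \<inter> - S)" for \<alpha> S
  have "\<exists>d>0. \<forall>\<alpha>. 0 < \<alpha> \<and> \<alpha> < d \<longrightarrow> \<gamma> (m \<alpha> (B k)) \<le> 1 / Suc k * \<gamma> (2 * \<alpha>)" for k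
    using x[of k] unfolding density_points_iff[OF \<gamma>] m_def
    by (metis of_nat_0_less_iff zero_less_Suc zero_less_divide_1_iff)
  then obtain d where d: "\<And>k. 0 < d k"
    "\<And>k \<alpha>. 0 < \<alpha> \<Longrightarrow> \<alpha> < d k \<Longrightarrow> \<gamma> (m \<alpha> (B k)) \<le> 1 / Suc k * \<gamma> (2 * \<alpha>)"
    by metis
  have "\<exists>h. \<forall>k. (0 < h k \<and> h k < d k \<and> h k \<le> 1 / Suc k) \<and>
      (h (Suc k) < h k \<and> \<gamma> (2 * h (Suc k)) \<le> 1 / Suc k * \<gamma> (2 * h k))"
  proof (rule dependent_nat_choice)
    show "\<exists>h>0. h < d 0 \<and> h \<le> 1 / Suc 0"
      using d(1)[of 0] by (intro exI[of _ "min (d 0 / 2) 1"]) auto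
  next
    fix h k
    assume h: "0 < h \<and> h < d k \<and> h \<le> 1 / Suc k"
    then have "0 < 1 / Suc k * \<gamma> (2 * h)"
      by (simp add: modulus_function_pos[OF \<gamma>])
    then obtain r where r: "0 < r" "\<And>a. 0 < a \<Longrightarrow> a < r \<Longrightarrow> \<gamma> a < 1 / Suc k * \<gamma> (2 * h)"
      using modulus_function_small[OF \<gamma>] by blast
    have "0 < min (min (r / 2) h) (min (d (Suc k)) (1 / Suc (Suc k)))"
      using r(1) h d(1)[of "Suc k"] by simp
    then obtain s where "0 < s" "s < min (min (r / 2) h) (min (d (Suc k)) (1 / Suc (Suc k)))"
      using dense by blast
    then have "0 < s" "s < r / 2" "s < h" "s < d (Suc k)" "s < 1 / Suc (Suc k)"
      by auto
    then show "\<exists>h'. (0 < h' \<and> h' < d (Suc k) \<and> h' \<le> 1 / Suc (Suc k)) \<and>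
        h' < h \<and> \<gamma> (2 * h') \<le> 1 / Suc k * \<gamma> (2 * h)"
      using r(2)[of "2 * s"] by (intro exI[of _ s]) auto
  qed
  then obtain h where h: "\<And>k. 0 < h k" "\<And>k. h k < d k" "\<And>k. h k \<le> 1 / Suc k"
    "\<And>k. h (Suc k) < h k" "\<And>k. \<gamma> (2 * h (Suc k)) \<le> 1 / Suc k * \<gamma> (2 * h k)"
    by blast
  have "decseq h"
    using h(4) by (intro decseq_SucI less_imp_le)
  define A where "A = B 0 \<inter> (\<Inter>k. B k \<union> - ball x (h k))"
  have "A \<in> sets lebesgue"
    unfolding A_def using meas
    by (intro sets.Int sets.countable_INT'' sets.Un) (auto simp: Compl_in_sets_lebesgue)
  moreover have "A \<subseteq> B 0"
    by (auto simp: A_def)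
  moreover have "A \<inter> ball x (h k) \<subseteq> B k" for k
    by (auto simp: A_def)
  moreover have "x \<in> density_points \<gamma> A"
    unfolding density_points_iff[OF \<gamma>] m_def[symmetric]
  proof (intro allI impI)
    have bound: "\<gamma> (m \<alpha> A) \<le> 3 / Suc k * \<gamma> (2 * \<alpha>)" if \<alpha>: "h (Suc k) \<le> \<alpha>" "\<alpha> < h k" for \<alpha> k
    proof -
      let ?I = "\<lambda>r. {x - r<..<x + r}"
      have "0 < \<alpha>"
        using \<alpha>(1) h(1)[of "Suc k"] by linarith
      \<comment> \<open>A point missing from \<open>A\<close> violates a constraint \<open>j\<close>. As \<open>B\<close> decreases, violations with
        \<open>j \<le> k\<close> are violations of \<open>B k\<close>; those with \<open>j \<ge> k + 2\<close> occur only near \<open>x\<close>.\<close>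
      have cover: "?I \<alpha> \<inter> - A \<subseteq> (?I \<alpha> \<inter> - B k) \<union> ((?I (h (Suc k)) \<inter> - B (Suc k)) \<union> ?I (h (Suc (Suc k))))"
      proof
        fix y
        assume y: "y \<in> ?I \<alpha> \<inter> - A"
        then consider "y \<notin> B 0" | j where "y \<notin> B j" "y \<in> ball x (h j)"
          by (auto simp: A_def)
        then show "y \<in> (?I \<alpha> \<inter> - B k) \<union> ((?I (h (Suc k)) \<inter> - B (Suc k)) \<union> ?I (h (Suc (Suc k))))"
        proof cases
          case 1
          then show ?thesis
            using y decseqD[OF dec, of 0 k] by auto
        next
          case j: 2
          consider "j \<le> k" | "j = Suc k" | "Suc (Suc k) \<le> j"
            by linarith
          then show ?thesis
          proof cases
            case 1
            then show ?thesis
              using y j(1) decseqD[OF dec, of j k] by auto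
          next
            case 2
            then show ?thesis
              using j by (auto simp: dist_real_def abs_less_iff)
          next
            case 3
            then show ?thesis
              using j(2) decseqD[OF \<open>decseq h\<close>, of "Suc (Suc k)" j]
              by (auto simp: dist_real_def abs_less_iff)
          qed
        qed
      qed
      have "m \<alpha> A \<le> measure lebesgue
          ((?I \<alpha> \<inter> - B k) \<union> ((?I (h (Suc k)) \<inter> - B (Suc k)) \<union> ?I (h (Suc (Suc k)))))"
        unfolding m_def using cover \<open>A \<in> sets lebesgue\<close> meas
        by (intro measure_mono_fmeasurable fmeasurable.Un lmeasurable_interval_Int_Compl)
           (simp_all add: fmeasurableD lmeasurable_interval_Int_Compl sets.Un)
      also have "\<dots> \<le> m \<alpha> (B k) + (m (h (Suc k)) (B (Suc k)) + 2 * h (Suc (Suc k)))"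
      proof -
        have "measure lebesgue (?I (h (Suc (Suc k)))) = 2 * h (Suc (Suc k))"
          using h(1)[of "Suc (Suc k)"] by simp
        moreover have "measure lebesgue ((?I (h (Suc k)) \<inter> - B (Suc k)) \<union> ?I (h (Suc (Suc k))))
            \<le> m (h (Suc k)) (B (Suc k)) + measure lebesgue (?I (h (Suc (Suc k))))"
          unfolding m_def using meas
          by (intro measure_Un_le) (simp_all add: fmeasurableD lmeasurable_interval_Int_Compl sets.Un)
        moreover have "measure lebesgue
            ((?I \<alpha> \<inter> - B k) \<union> ((?I (h (Suc k)) \<inter> - B (Suc k)) \<union> ?I (h (Suc (Suc k)))))
            \<le> m \<alpha> (B k) + measure lebesgue ((?I (h (Suc k)) \<inter> - B (Suc k)) \<union> ?I (h (Suc (Suc k))))"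
          unfolding m_def using meas
          by (intro measure_Un_le) (simp_all add: fmeasurableD lmeasurable_interval_Int_Compl sets.Un)
        ultimately show ?thesis by linarith
      qed
      finally have "\<gamma> (m \<alpha> A) \<le> \<gamma> (m \<alpha> (B k)) + \<gamma> (m (h (Suc k)) (B (Suc k)) + 2 * h (Suc (Suc k)))"
        using h(1)[of "Suc (Suc k)"]
        by (intro modulus_function_mono_add[OF \<gamma>]) (auto simp: m_def)
      moreover have "\<gamma> (m (h (Suc k)) (B (Suc k)) + 2 * h (Suc (Suc k)))
          \<le> \<gamma> (m (h (Suc k)) (B (Suc k))) + \<gamma> (2 * h (Suc (Suc k)))"
        using h(1)[of "Suc (Suc k)"]
        by (intro modulus_function_subadditive[OF \<gamma>]) (auto simp: m_def)
      moreover have "\<gamma> (m \<alpha> (B k)) \<le> 1 / Suc k * \<gamma> (2 * \<alpha>)"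
        using d(2) \<open>0 < \<alpha>\<close> \<alpha>(2) h(2)[of k] by simp
      moreover have "\<gamma> (m (h (Suc k)) (B (Suc k))) \<le> 1 / Suc k * \<gamma> (2 * \<alpha>)"
      proof -
        have "\<gamma> (m (h (Suc k)) (B (Suc k))) \<le> 1 / Suc (Suc k) * \<gamma> (2 * h (Suc k))"
          using d(2) h(1,2) by blast
        also have "\<dots> \<le> 1 / Suc k * \<gamma> (2 * \<alpha>)"
          using \<alpha>(1) h(1)[of "Suc k"]
          by (intro mult_mono modulus_function_mono[OF \<gamma>] modulus_function_nonneg[OF \<gamma>])
             (auto simp: divide_simps)
        finally show ?thesis .
      qed
      moreover have "\<gamma> (2 * h (Suc (Suc k))) \<le> 1 / Suc k * \<gamma> (2 * \<alpha>)"
      proof -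
        have "\<gamma> (2 * h (Suc (Suc k))) \<le> 1 / Suc (Suc k) * \<gamma> (2 * h (Suc k))"
          using h(5) by blast
        also have "\<dots> \<le> 1 / Suc k * \<gamma> (2 * \<alpha>)"
          using \<alpha>(1) h(1)[of "Suc k"]
          by (intro mult_mono modulus_function_mono[OF \<gamma>] modulus_function_nonneg[OF \<gamma>])
             (auto simp: divide_simps)
        finally show ?thesis .
      qed
      ultimately have "\<gamma> (m \<alpha> A) \<le> 3 * (1 / Suc k * \<gamma> (2 * \<alpha>))"
        by linarith
      then show ?thesis
        by simp
    qed
    fix e :: real
    assume "0 < e"
    then obtain N where "inverse (Suc N) < e / 3"
      using reals_Archimedean[of "e / 3"] by auto
    then have N: "3 / Suc N \<le> e"
      by (simp add: field_simps)
    have "\<gamma> (m \<alpha> A) \<le> e * \<gamma> (2 * \<alpha>)" if \<alpha>: "0 < \<alpha>" "\<alpha> < h N" for \<alpha>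
    proof -
      \<comment> \<open>Locate \<open>\<alpha>\<close> between consecutive radii: \<open>h (Suc k) \<le> \<alpha> < h k\<close>.\<close>
      define j where "j = (LEAST j. h j \<le> \<alpha>)"
      have "\<exists>j. h j \<le> \<alpha>"
        using reals_Archimedean[OF \<alpha>(1)] h(3) by (metis inverse_eq_divide less_imp_le order_trans)
      then have j: "h j \<le> \<alpha>"
        unfolding j_def by (rule LeastI_ex)
      then have "N < j"
        using \<alpha>(2) decseqD[OF \<open>decseq h\<close>, of j N] by (intro not_le_imp_less) auto
      then obtain k where k: "j = Suc k" "N \<le> k"
        by (cases j) auto
      have "\<alpha> < h k"
        using not_less_Least[of k "\<lambda>j. h j \<le> \<alpha>"] k(1) by (auto simp: j_def)
      then have "\<gamma> (m \<alpha> A) \<le> 3 / Suc k * \<gamma> (2 * \<alpha>)"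
        using bound j k(1) by blast
      also have "\<dots> \<le> e * \<gamma> (2 * \<alpha>)"
      proof (rule mult_right_mono)
        have "3 / Suc k \<le> 3 / Suc N"
          using k(2) by (simp add: divide_simps)
        then show "3 / Suc k \<le> e"
          using N by linarith
      qed (use \<alpha>(1) in \<open>simp add: modulus_function_nonneg[OF \<gamma>]\<close>)
      finally show ?thesis .
    qed
    with h(1)[of N] show "\<exists>d>0. \<forall>\<alpha>. 0 < \<alpha> \<and> \<alpha> < d \<longrightarrow> \<gamma> (m \<alpha> A) \<le> e * \<gamma> (2 * \<alpha>)"
      by blast
  qed
  ultimately show ?thesis
    using that[of A h] h(1) by blast
qed

lemma density_points_diagonal:
  assumes \<gamma>: "modulus_function \<gamma>"
    and meas: "\<And>k. C k \<in> sets lebesgue"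
    and x: "\<And>k. x \<in> density_points \<gamma> (C k)"
  obtains A h where "A \<in> sets lebesgue" "A \<subseteq> C 0" "x \<in> density_points \<gamma> A"
    "\<And>k::nat. 0 < h k" "\<And>k. A \<inter> ball x (h k) \<subseteq> C k"
proof -
  define B where "B k = (\<Inter>j\<le>k. C j)" for k
  have B_Suc: "B (Suc k) = B k \<inter> C (Suc k)" for k
    by (auto simp: B_def atMost_Suc)
  have "B k \<in> sets lebesgue" for k
    by (induction k) (auto simp: B_Suc meas, simp add: B_def meas)
  moreover from this have "x \<in> density_points \<gamma> (B k)" for k
    by (induction k) (auto simp: B_Suc meas x intro!: density_points_Int[OF \<gamma>], simp add: B_def x)
  moreover have "decseq B"
    by (intro decseq_SucI) (simp add: B_Suc)
  moreover have "B k \<subseteq> C k" for k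
    by (auto simp: B_def)
  ultimately obtain A h where "A \<in> sets lebesgue" "A \<subseteq> B 0" "x \<in> density_points \<gamma> A"
    "\<And>k::nat. 0 < h k" "\<And>k. A \<inter> ball x (h k) \<subseteq> B k"
    by (metis density_points_decseq_diagonal[OF \<gamma>])
  with \<open>\<And>k. B k \<subseteq> C k\<close> show ?thesis
    by (intro that[of A h]) blast+
qed


section \<open>Approximate continuity\<close>

text \<open>
  The witness may depend on \<open>\<epsilon>\<close>: witnesses for \<open>\<epsilon> = 1 / (k + 1)\<close> are merged by the diagonal
  construction, and the merged set yields convergence because near \<open>x0\<close> it lies in each of them.
  Conversely, a single witness is cut down to a small ball. The point \<open>x0\<close> itself, which the limit
  ignores, is harmless in the inequality.
\<close>

lemma approx_continuous_on_iff:
  assumes \<gamma>: "modulus_function \<gamma>"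
  shows "approx_continuous_on \<gamma> X f \<longleftrightarrow>
    (\<forall>x0\<in>X. \<forall>e>0. \<exists>A\<in>sets lebesgue. A \<subseteq> X \<and> x0 \<in> density_points \<gamma> A \<and>
       (\<forall>x\<in>A. \<bar>f x - f x0\<bar> < e))"
proof (intro iffI ballI allI impI)
  fix x0 and e :: real
  assume "approx_continuous_on \<gamma> X f" "x0 \<in> X" "0 < e"
  then obtain A where A: "A \<in> sets lebesgue" "A \<subseteq> X" "x0 \<in> density_points \<gamma> A"
    "(f \<longlongrightarrow> f x0) (at x0 within A)"
    by (auto simp: approx_continuous_on_def)
  from A(4) \<open>0 < e\<close> obtain d where d: "0 < d"
    "\<And>x. x \<in> A \<Longrightarrow> x \<noteq> x0 \<Longrightarrow> dist x x0 < d \<Longrightarrow> dist (f x) (f x0) < e"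
    by (auto simp: tendsto_iff eventually_at)
  have "\<bar>f x - f x0\<bar> < e" if "x \<in> A \<inter> ball x0 d" for x
    using d(2)[of x] that \<open>0 < e\<close> by (cases "x = x0") (auto simp: dist_real_def abs_minus_commute)
  with A d(1) show "\<exists>A\<in>sets lebesgue. A \<subseteq> X \<and> x0 \<in> density_points \<gamma> A \<and> (\<forall>x\<in>A. \<bar>f x - f x0\<bar> < e)"
    by (intro bexI[of _ "A \<inter> ball x0 d"] conjI density_points_Int_ball[OF \<gamma>]) auto
next
  assume local: "\<forall>x0\<in>X. \<forall>e>0. \<exists>A\<in>sets lebesgue. A \<subseteq> X \<and> x0 \<in> density_points \<gamma> A \<and>
    (\<forall>x\<in>A. \<bar>f x - f x0\<bar> < e)"
  show "approx_continuous_on \<gamma> X f"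
    unfolding approx_continuous_on_def
  proof
    fix x0
    assume "x0 \<in> X"
    with local have "\<exists>A. A \<in> sets lebesgue \<and> A \<subseteq> X \<and> x0 \<in> density_points \<gamma> A \<and>
        (\<forall>x\<in>A. \<bar>f x - f x0\<bar> < 1 / Suc k)" for k
      by (metis of_nat_0_less_iff zero_less_Suc zero_less_divide_1_iff)
    then obtain C where C: "\<And>k. C k \<in> sets lebesgue" "\<And>k. C k \<subseteq> X"
      "\<And>k. x0 \<in> density_points \<gamma> (C k)" "\<And>k x. x \<in> C k \<Longrightarrow> \<bar>f x - f x0\<bar> < 1 / Suc k"
      by metis
    obtain A h where A: "A \<in> sets lebesgue" "A \<subseteq> C 0" "x0 \<in> density_points \<gamma> A"
      "\<And>k::nat. 0 < h k" "\<And>k. A \<inter> ball x0 (h k) \<subseteq> C k"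
      using density_points_diagonal[of \<gamma> C x0] \<gamma> C(1,3) by metis
    have "(f \<longlongrightarrow> f x0) (at x0 within A)"
      unfolding tendsto_iff
    proof (intro allI impI)
      fix e :: real
      assume "0 < e"
      then obtain k where k: "1 / Suc k < e"
        using reals_Archimedean by (metis inverse_eq_divide)
      have "dist (f x) (f x0) < e" if "x \<in> A" "dist x x0 < h k" for x
      proof -
        have "x \<in> C k"
          using A(5)[of k] that by (auto simp: dist_commute)
        then show ?thesis
          using C(4)[of x k] k by (simp add: dist_real_def)
      qed
      with A(4)[of k] show "\<forall>\<^sub>F x in at x0 within A. dist (f x) (f x0) < e"
        by (auto simp: eventually_at)
    qed
    with A C(2)[of 0] show "\<exists>A\<in>sets lebesgue. A \<subseteq> X \<and> x0 \<in> density_points \<gamma> A \<and>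
        (f \<longlongrightarrow> f x0) (at x0 within A)"
      by blast
  qed
qed

lemma approx_continuous_on_cong:
  assumes \<gamma>: "modulus_function \<gamma>" and eq: "\<And>x. x \<in> X \<Longrightarrow> f x = g x"
  shows "approx_continuous_on \<gamma> X f \<longleftrightarrow> approx_continuous_on \<gamma> X g"
  unfolding approx_continuous_on_iff[OF \<gamma>]
proof (intro ball_cong refl all_cong imp_cong bex_cong conj_cong)
  fix x0 and e :: real and A x
  assume "x0 \<in> X" "A \<subseteq> X" "x \<in> A"
  then show "\<bar>f x - f x0\<bar> < e \<longleftrightarrow> \<bar>g x - g x0\<bar> < e"
    using eq[of x] eq[of x0] by auto
qed

text \<open>
  The function \<open>f\<close> only serves to ensure that each point of \<open>X\<close> is a density point of some
  measurable subset of \<open>X\<close>.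
\<close>

lemma approx_continuous_on_const:
  assumes "approx_continuous_on \<gamma> X f"
  shows "approx_continuous_on \<gamma> X (\<lambda>x. c)"
  unfolding approx_continuous_on_def
proof
  fix x0
  assume "x0 \<in> X"
  then obtain A where "A \<in> sets lebesgue" "A \<subseteq> X" "x0 \<in> density_points \<gamma> A"
    using assms unfolding approx_continuous_on_def by blast
  then show "\<exists>A\<in>sets lebesgue. A \<subseteq> X \<and> x0 \<in> density_points \<gamma> A \<and> ((\<lambda>x. c) \<longlongrightarrow> c) (at x0 within A)"
    by auto
qed

lemma approx_continuous_on_add:
  assumes \<gamma>: "modulus_function \<gamma>"
    and f: "approx_continuous_on \<gamma> X f" and g: "approx_continuous_on \<gamma> X g"
  shows "approx_continuous_on \<gamma> X (\<lambda>x. f x + g x)"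
  unfolding approx_continuous_on_iff[OF \<gamma>]
proof (intro ballI allI impI)
  fix x0 and e :: real
  assume "x0 \<in> X" "0 < e"
  then have "0 < e / 2" by simp
  obtain A where A: "A \<in> sets lebesgue" "A \<subseteq> X" "x0 \<in> density_points \<gamma> A"
    "\<And>x. x \<in> A \<Longrightarrow> \<bar>f x - f x0\<bar> < e / 2"
    using f \<open>x0 \<in> X\<close> \<open>0 < e / 2\<close> unfolding approx_continuous_on_iff[OF \<gamma>] by meson
  obtain B where B: "B \<in> sets lebesgue" "B \<subseteq> X" "x0 \<in> density_points \<gamma> B"
    "\<And>x. x \<in> B \<Longrightarrow> \<bar>g x - g x0\<bar> < e / 2"
    using g \<open>x0 \<in> X\<close> \<open>0 < e / 2\<close> unfolding approx_continuous_on_iff[OF \<gamma>] by meson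
  have "\<bar>f x + g x - (f x0 + g x0)\<bar> < e" if "x \<in> A \<inter> B" for x
  proof -
    have "\<bar>f x - f x0\<bar> < e / 2" "\<bar>g x - g x0\<bar> < e / 2"
      using A(4) B(4) that by auto
    then show ?thesis by linarith
  qed
  with A B show "\<exists>A\<in>sets lebesgue. A \<subseteq> X \<and> x0 \<in> density_points \<gamma> A \<and>
      (\<forall>x\<in>A. \<bar>f x + g x - (f x0 + g x0)\<bar> < e)"
    by (intro bexI[of _ "A \<inter> B"] conjI density_points_Int[OF \<gamma>]) auto
qed

lemma approx_continuous_on_cmult:
  assumes "approx_continuous_on \<gamma> X f"
  shows "approx_continuous_on \<gamma> X (\<lambda>x. c * f x)"
  unfolding approx_continuous_on_def
proof
  fix x0
  assume "x0 \<in> X"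
  then obtain A where "A \<in> sets lebesgue" "A \<subseteq> X" "x0 \<in> density_points \<gamma> A"
    "(f \<longlongrightarrow> f x0) (at x0 within A)"
    using assms unfolding approx_continuous_on_def by blast
  then show "\<exists>A\<in>sets lebesgue. A \<subseteq> X \<and> x0 \<in> density_points \<gamma> A \<and>
      ((\<lambda>x. c * f x) \<longlongrightarrow> c * f x0) (at x0 within A)"
    by (intro bexI[of _ A] conjI tendsto_mult_left)
qed

text \<open>
  By \<open>approx_continuous_on_iff\<close>, for given \<open>\<epsilon>\<close> the witness of one approximant within \<open>\<epsilon>/3\<close> of the
  limit is good enough; no witness has to work for several approximants.
\<close>

lemma approx_continuous_on_uniform_limit:
  assumes \<gamma>: "modulus_function \<gamma>"
    and f: "\<And>n. approx_continuous_on \<gamma> X (f n)"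
    and lim: "uniform_limit X f l sequentially"
  shows "approx_continuous_on \<gamma> X l"
  unfolding approx_continuous_on_iff[OF \<gamma>]
proof (intro ballI allI impI)
  fix x0 and e :: real
  assume "x0 \<in> X" "0 < e"
  then have "0 < e / 3" by simp
  then have "\<forall>\<^sub>F n in sequentially. \<forall>x\<in>X. dist (f n x) (l x) < e / 3"
    by (rule uniform_limitD[OF lim])
  then obtain n where n: "\<And>x. x \<in> X \<Longrightarrow> \<bar>f n x - l x\<bar> < e / 3"
    by (auto simp: eventually_sequentially dist_real_def)
  obtain A where A: "A \<in> sets lebesgue" "A \<subseteq> X" "x0 \<in> density_points \<gamma> A"
    "\<And>x. x \<in> A \<Longrightarrow> \<bar>f n x - f n x0\<bar> < e / 3"
    using f[of n] \<open>x0 \<in> X\<close> \<open>0 < e / 3\<close> unfolding approx_continuous_on_iff[OF \<gamma>] by meson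
  have "\<bar>l x - l x0\<bar> < e" if "x \<in> A" for x
  proof -
    have "\<bar>f n x - l x\<bar> < e / 3"
      using n that A(2) by blast
    then show ?thesis
      using A(4)[OF that] n[OF \<open>x0 \<in> X\<close>] by linarith
  qed
  with A show "\<exists>A\<in>sets lebesgue. A \<subseteq> X \<and> x0 \<in> density_points \<gamma> A \<and> (\<forall>x\<in>A. \<bar>l x - l x0\<bar> < e)"
    by blast
qed


section \<open>Function spaces with the supremum norm\<close>

lemma bounded_fun_on_iff: "bounded_fun_on X f \<longleftrightarrow> (\<exists>M. \<forall>x\<in>X. \<bar>f x\<bar> \<le> M)"
  unfolding bounded_fun_on_def
proof safe
  fix M
  assume "\<forall>x\<in>X. \<bar>f x\<bar> \<le> M"
  then show "\<exists>M>0. \<forall>x\<in>X. \<bar>f x\<bar> \<le> M"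
    by (intro exI[of _ "max M 1"]) auto
qed blast

lemma abs_le_sup_norm:
  assumes "bounded_fun_on X f" "x \<in> X"
  shows "\<bar>f x\<bar> \<le> sup_norm X f"
proof -
  have "bdd_above ((\<lambda>x. \<bar>f x\<bar>) ` X)"
    using assms(1) by (auto simp: bounded_fun_on_iff bdd_above_def)
  then show ?thesis
    using assms(2) by (auto simp: sup_norm_def intro: cSUP_upper)
qed

lemma sup_norm_le:
  assumes "0 \<le> M" "\<And>x. x \<in> X \<Longrightarrow> \<bar>f x\<bar> \<le> M"
  shows "sup_norm X f \<le> M"
  using assms by (auto simp: sup_norm_def intro!: cSUP_least)

lemma sup_norm_nonneg:
  assumes "bounded_fun_on X f"
  shows "0 \<le> sup_norm X f"
proof (cases "X = {}")
  case False
  then obtain x where "x \<in> X" by blast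
  then show ?thesis
    using abs_le_sup_norm[OF assms, of x] by linarith
qed (simp add: sup_norm_def)

lemma sup_norm_cmult_le:
  assumes "bounded_fun_on X f"
  shows "sup_norm X (\<lambda>x\<in>X. c * f x) \<le> \<bar>c\<bar> * sup_norm X f"
  using assms
  by (intro sup_norm_le) (auto simp: abs_mult sup_norm_nonneg abs_le_sup_norm intro!: mult_left_mono)

text \<open>The lower bound for \<open>c \<noteq> 0\<close> is \<open>sup_norm_cmult_le\<close> for \<open>inverse c\<close> and \<open>c * f\<close>.\<close>

lemma sup_norm_cmult:
  assumes f: "bounded_fun_on X f"
  shows "sup_norm X (\<lambda>x\<in>X. c * f x) = \<bar>c\<bar> * sup_norm X f"
proof (cases "c = 0")
  case True
  then show ?thesis by (simp add: sup_norm_def)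
next
  case False
  let ?g = "\<lambda>x\<in>X. c * f x"
  obtain M where M: "\<And>x. x \<in> X \<Longrightarrow> \<bar>f x\<bar> \<le> M"
    using f by (auto simp: bounded_fun_on_iff)
  then have g: "bounded_fun_on X ?g"
    unfolding bounded_fun_on_iff
    by (intro exI[of _ "\<bar>c\<bar> * M"]) (auto simp: abs_mult intro!: mult_left_mono)
  have "sup_norm X f = sup_norm X (\<lambda>x\<in>X. inverse c * ?g x)"
    using False by (simp add: sup_norm_def mult.assoc[symmetric])
  also have "\<dots> \<le> \<bar>inverse c\<bar> * sup_norm X ?g"
    by (rule sup_norm_cmult_le[OF g])
  finally have "\<bar>c\<bar> * sup_norm X f \<le> sup_norm X ?g"
    using False by (simp add: field_simps abs_inverse)
  with sup_norm_cmult_le[OF f, of c] show ?thesis by linarith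
qed

lemma BAC_zero:
  assumes "modulus_function \<gamma>" "BAC \<gamma> X \<noteq> {}"
  shows "(\<lambda>x\<in>X. 0) \<in> BAC \<gamma> X"
proof -
  obtain f where "approx_continuous_on \<gamma> X f"
    using assms(2) by (auto simp: BAC_def)
  then have "approx_continuous_on \<gamma> X (\<lambda>x. 0)"
    by (rule approx_continuous_on_const)
  then have "approx_continuous_on \<gamma> X (\<lambda>x\<in>X. 0)"
    by (subst approx_continuous_on_cong[OF assms(1), where g = "\<lambda>x. 0"]) auto
  then show ?thesis
    by (auto simp: BAC_def bounded_fun_on_iff)
qed

lemma BAC_add:
  assumes \<gamma>: "modulus_function \<gamma>" and f: "f \<in> BAC \<gamma> X" and g: "g \<in> BAC \<gamma> X"
  shows "(\<lambda>x\<in>X. f x + g x) \<in> BAC \<gamma> X"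
proof -
  have "approx_continuous_on \<gamma> X (\<lambda>x. f x + g x)"
    using f g by (intro approx_continuous_on_add[OF \<gamma>]) (auto simp: BAC_def)
  then have "approx_continuous_on \<gamma> X (\<lambda>x\<in>X. f x + g x)"
    by (subst approx_continuous_on_cong[OF \<gamma>, where g = "\<lambda>x. f x + g x"]) auto
  moreover obtain M N where MN: "\<And>x. x \<in> X \<Longrightarrow> \<bar>f x\<bar> \<le> M" "\<And>x. x \<in> X \<Longrightarrow> \<bar>g x\<bar> \<le> N"
    using f g by (auto simp: BAC_def bounded_fun_on_iff)
  have "bounded_fun_on X (\<lambda>x\<in>X. f x + g x)"
    unfolding bounded_fun_on_iff
    by (intro exI[of _ "M + N"]) (auto intro!: order_trans[OF abs_triangle_ineq] add_mono MN)
  ultimately show ?thesis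
    by (simp add: BAC_def)
qed

lemma BAC_cmult:
  assumes \<gamma>: "modulus_function \<gamma>" and f: "f \<in> BAC \<gamma> X"
  shows "(\<lambda>x\<in>X. c * f x) \<in> BAC \<gamma> X"
proof -
  have "approx_continuous_on \<gamma> X (\<lambda>x. c * f x)"
    using f by (intro approx_continuous_on_cmult) (auto simp: BAC_def)
  then have "approx_continuous_on \<gamma> X (\<lambda>x\<in>X. c * f x)"
    by (subst approx_continuous_on_cong[OF \<gamma>, where g = "\<lambda>x. c * f x"]) auto
  moreover obtain M where M: "\<And>x. x \<in> X \<Longrightarrow> \<bar>f x\<bar> \<le> M"
    using f by (auto simp: BAC_def bounded_fun_on_iff)
  have "bounded_fun_on X (\<lambda>x\<in>X. c * f x)"
    unfolding bounded_fun_on_iff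
    by (intro exI[of _ "\<bar>c\<bar> * M"]) (auto simp: abs_mult intro!: mult_left_mono M)
  ultimately show ?thesis
    by (simp add: BAC_def)
qed

lemma BAC_uniform_limit:
  assumes \<gamma>: "modulus_function \<gamma>" and f: "\<And>n. f n \<in> BAC \<gamma> X"
    and lim: "uniform_limit X f l sequentially" and l: "l \<in> extensional X"
  shows "l \<in> BAC \<gamma> X"
proof -
  have "approx_continuous_on \<gamma> X l"
    using f by (intro approx_continuous_on_uniform_limit[OF \<gamma> _ lim]) (auto simp: BAC_def)
  moreover have "bounded_fun_on X l"
  proof -
    have "\<forall>\<^sub>F n in sequentially. \<forall>x\<in>X. dist (f n x) (l x) < 1"
      by (rule uniform_limitD[OF lim]) simp
    then obtain n where n: "\<And>x. x \<in> X \<Longrightarrow> \<bar>f n x - l x\<bar> < 1"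
      by (auto simp: eventually_sequentially dist_real_def)
    obtain M where "\<And>x. x \<in> X \<Longrightarrow> \<bar>f n x\<bar> \<le> M"
      using f[of n] by (auto simp: BAC_def bounded_fun_on_iff)
    with n have "\<bar>l x\<bar> \<le> M + 1" if "x \<in> X" for x
      using that by (smt (verit))
    then show ?thesis
      by (auto simp: bounded_fun_on_iff)
  qed
  ultimately show ?thesis
    using l by (simp add: BAC_def)
qed

text \<open>
  Extensionality ensures that \<open>0 + f\<close> and \<open>1 * f\<close>, which are
  restricted to \<open>X\<close> by definition, agree with \<open>f\<close> everywhere.
\<close>

lemma module_fun_space:
  assumes ext: "F \<subseteq> extensional X"
    and zero: "(\<lambda>x\<in>X. 0) \<in> F"
    and add: "\<And>f g. f \<in> F \<Longrightarrow> g \<in> F \<Longrightarrow> (\<lambda>x\<in>X. f x + g x) \<in> F"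
    and cmult: "\<And>c f. f \<in> F \<Longrightarrow> (\<lambda>x\<in>X. c * f x) \<in> F"
  shows "module reals_ring (fun_space X F)"
proof (rule moduleI)
  show "cring reals_ring"
    using field_reals_ring by (simp add: field_def domain_def)
  show "abelian_group (fun_space X F)"
  proof (rule abelian_groupI, goal_cases)
    case (5 f)
    then show ?case
      using ext by (force simp: fun_space_def extensional_def)
  next
    case (6 f)
    then show ?case
      by (intro bexI[of _ "\<lambda>x\<in>X. (- 1) * f x"]) (use cmult[of f "- 1"] in \<open>auto simp: fun_space_def\<close>)
  qed (auto simp: fun_space_def zero add algebra_simps)
qed (use ext in \<open>force simp: fun_space_def reals_ring_def cmult algebra_simps extensional_def\<close>)+

lemma fun_space_minus:
  assumes V: "module reals_ring (fun_space X F)"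
    and cmult: "\<And>c f. f \<in> F \<Longrightarrow> (\<lambda>x\<in>X. c * f x) \<in> F"
    and f: "f \<in> F" and g: "g \<in> F"
  shows "f \<ominus>\<^bsub>fun_space X F\<^esub> g = (\<lambda>x\<in>X. f x - g x)"
proof -
  interpret module reals_ring "fun_space X F" by (rule V)
  have "\<ominus>\<^bsub>fun_space X F\<^esub> g = (\<lambda>x\<in>X. - g x)"
  proof (rule M.minus_equality)
    show "(\<lambda>x\<in>X. - g x) \<in> carrier (fun_space X F)"
      using cmult[OF g, of "- 1"] by (simp add: fun_space_def)
  qed (use g in \<open>auto simp: fun_space_def\<close>)
  then show ?thesis
    unfolding M.minus_eq by (auto simp: fun_space_def)
qed

theorem theorem18:
  fixes \<gamma> :: "real \<Rightarrow> real" and X :: "real set"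
  assumes "modulus_function \<gamma>"
    and "BAC \<gamma> X \<noteq> {}"
  shows "real_banach_space (fun_space X (BAC \<gamma> X)) (sup_norm X)"
proof -
  note \<gamma> = assms(1)
  let ?V = "fun_space X (BAC \<gamma> X)"
  have carrier: "carrier ?V = BAC \<gamma> X"
    by (simp add: fun_space_def)
  have bdd: "bounded_fun_on X f" if "f \<in> BAC \<gamma> X" for f
    using that by (simp add: BAC_def)
  have V: "module reals_ring ?V"
    using BAC_zero[OF assms] BAC_add[OF \<gamma>] BAC_cmult[OF \<gamma>]
    by (intro module_fun_space) (auto simp: BAC_def)
  have minus: "f \<ominus>\<^bsub>?V\<^esub> g = (\<lambda>x\<in>X. f x - g x)" if "f \<in> BAC \<gamma> X" "g \<in> BAC \<gamma> X" for f g
    using that by (intro fun_space_minus[OF V]) (auto intro: BAC_cmult[OF \<gamma>])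
  \<comment> \<open>Values at the points of \<open>X\<close> are controlled by the norm only for bounded functions.\<close>
  have bdd_minus: "bounded_fun_on X (\<lambda>x\<in>X. f x - g x)" if "f \<in> BAC \<gamma> X" "g \<in> BAC \<gamma> X" for f g
  proof -
    have "(\<lambda>x\<in>X. f x + (\<lambda>x\<in>X. (- 1) * g x) x) \<in> BAC \<gamma> X"
      using that by (intro BAC_add[OF \<gamma>] BAC_cmult[OF \<gamma>])
    moreover have "(\<lambda>x\<in>X. f x + (\<lambda>x\<in>X. (- 1) * g x) x) = (\<lambda>x\<in>X. f x - g x)"
      by auto
    ultimately show ?thesis
      using bdd by metis
  qed
  show ?thesis
  proof (intro real_banach_space.intro[OF V] real_banach_space_axioms.intro; (unfold carrier)?)
    fix u
    assume u: "u \<in> BAC \<gamma> X"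
    show "0 \<le> sup_norm X u"
      by (rule sup_norm_nonneg[OF bdd[OF u]])
    show "sup_norm X u = 0 \<longleftrightarrow> u = \<zero>\<^bsub>?V\<^esub>"
    proof
      assume "sup_norm X u = 0"
      then have "u x = 0" if "x \<in> X" for x
        using abs_le_sup_norm[OF bdd[OF u] that] by simp
      with u show "u = \<zero>\<^bsub>?V\<^esub>"
        by (auto simp: fun_space_def BAC_def extensional_def)
    next
      assume "u = \<zero>\<^bsub>?V\<^esub>"
      then show "sup_norm X u = 0"
        by (simp add: fun_space_def sup_norm_def)
    qed
    show "sup_norm X (c \<odot>\<^bsub>?V\<^esub> u) = \<bar>c\<bar> * sup_norm X u" for c
      using sup_norm_cmult[OF bdd[OF u]] by (simp add: fun_space_def)
    fix v
    assume v: "v \<in> BAC \<gamma> X"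
    show "sup_norm X (u \<oplus>\<^bsub>?V\<^esub> v) \<le> sup_norm X u + sup_norm X v"
      using u v by (auto simp: fun_space_def bdd intro!: sup_norm_le add_nonneg_nonneg sup_norm_nonneg
        order_trans[OF abs_triangle_ineq] add_mono abs_le_sup_norm)
  next
    fix \<sigma> :: "nat \<Rightarrow> real \<Rightarrow> real"
    assume \<sigma>: "\<And>n. \<sigma> n \<in> BAC \<gamma> X"
      and Cauchy: "\<And>e. 0 < e \<Longrightarrow> \<exists>N. \<forall>m\<ge>N. \<forall>n\<ge>N. sup_norm X (\<sigma> m \<ominus>\<^bsub>?V\<^esub> \<sigma> n) < e"
    have "uniformly_Cauchy_on X \<sigma>"
      unfolding uniformly_Cauchy_on_def
    proof (intro allI impI)
      fix e :: real
      assume "0 < e"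
      then obtain N where N: "\<And>m n. N \<le> m \<Longrightarrow> N \<le> n \<Longrightarrow> sup_norm X (\<sigma> m \<ominus>\<^bsub>?V\<^esub> \<sigma> n) < e"
        using Cauchy by blast
      have "dist (\<sigma> m x) (\<sigma> n x) < e" if "x \<in> X" "N \<le> m" "N \<le> n" for x m n
        using abs_le_sup_norm[OF bdd_minus[OF \<sigma> \<sigma>] that(1), of m n] N[OF that(2,3)] that(1)
        by (simp add: minus \<sigma> dist_real_def)
      then show "\<exists>N. \<forall>x\<in>X. \<forall>m\<ge>N. \<forall>n\<ge>N. dist (\<sigma> m x) (\<sigma> n x) < e"
        by blast
    qed
    then obtain l0 where "uniform_limit X \<sigma> l0 sequentially"
      using Cauchy_uniformly_convergent by (auto simp: uniformly_convergent_on_def)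
    then have lim: "uniform_limit X \<sigma> (restrict l0 X) sequentially"
      by (subst uniform_limit_cong'[where g = \<sigma> and i = l0]) auto
    then have l: "restrict l0 X \<in> BAC \<gamma> X"
      by (rule BAC_uniform_limit[OF \<gamma> \<sigma>]) simp
    have "(\<lambda>n. sup_norm X (\<sigma> n \<ominus>\<^bsub>?V\<^esub> restrict l0 X)) \<longlonglongrightarrow> 0"
      unfolding tendsto_iff
    proof (intro allI impI)
      fix e :: real
      assume "0 < e"
      then have "\<forall>\<^sub>F n in sequentially. \<forall>x\<in>X. dist (\<sigma> n x) (restrict l0 X x) < e / 2"
        by (intro uniform_limitD[OF lim]) simp
      then show "\<forall>\<^sub>F n in sequentially. dist (sup_norm X (\<sigma> n \<ominus>\<^bsub>?V\<^esub> restrict l0 X)) 0 < e"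
      proof (rule eventually_mono)
        fix n
        assume near: "\<forall>x\<in>X. dist (\<sigma> n x) (restrict l0 X x) < e / 2"
        have "sup_norm X (\<lambda>x\<in>X. \<sigma> n x - restrict l0 X x) \<le> e / 2"
          using near \<open>0 < e\<close> by (intro sup_norm_le) (auto simp: dist_real_def intro: less_imp_le)
        moreover have "0 \<le> sup_norm X (\<lambda>x\<in>X. \<sigma> n x - restrict l0 X x)"
          by (rule sup_norm_nonneg[OF bdd_minus[OF \<sigma> l]])
        ultimately show "dist (sup_norm X (\<sigma> n \<ominus>\<^bsub>?V\<^esub> restrict l0 X)) 0 < e"
          using \<open>0 < e\<close> unfolding minus[OF \<sigma> l] by (simp add: dist_real_def)
      qed
    qed
    with l show "\<exists>l\<in>BAC \<gamma> X. (\<lambda>n. sup_norm X (\<sigma> n \<ominus>\<^bsub>?V\<^esub> l)) \<longlonglongrightarrow> 0"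
      by blast
  qed
qed

end
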